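(* For every positive integer $c$, there exists a positive integer $n(c)$ such that the $n(c)$-Mycielski graph $M_{n(c)}$ has path-chromatic number larger than $c$.
   Context: Graphs are finite and simple. A path-decomposition of a graph $G$ is a sequence $B_1,\dots,B_s$ of subsets of $V(G)$ (bags) such that $V(G)=\bigcup_t B_t$; for each $uv\in E(G)$ there is $t$ with $u,v\in B_t$; and for each $v\in V(G)$ the sets $B_t$ containing $v$ are consecutive in the sequence. The chromatic number of a path-decomposition is $\max_t \chi(G[B_t])$. The path-chromatic number $\chi_P(G)$ is the minimum chromatic number over all path-decompositions of $G$. For $k\ge 2$, the $k$-Mycielski graph $M_k$ is the graph with $3\cdot 2^{k-2}-1$ vertices constructed recursively as follows. $M_2$ is a single edge (on two vertices). For $k\ge 3$, let $v_1,\dots,v_{N}$ with $N=3\cdot 2^{k-3}-1$ be the vertices of $M_{k-1}$; $M_k$ is obtained from $M_{k-1}$ by adding new vertices $w,u_1,\dots,u_N$, the edges $wu_i$ for all $i$, and the edges $u_iv_j$ for all $i\ne j$ such that $v_iv_j\in E(M_{k-1})$. *)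

theory Defs
  imports Main
begin

record 'a ugraph =
  verts :: "'a set"
  edges :: "'a set set"

definition finite_simple_graph :: "'a ugraph \<Rightarrow> bool" where
  "finite_simple_graph G \<longleftrightarrow>
     finite (verts G) \<and> (\<forall>e\<in>edges G. e \<subseteq> verts G \<and> card e = 2)"

definition induced_subgraph :: "'a ugraph \<Rightarrow> 'a set \<Rightarrow> 'a ugraph" where
  "induced_subgraph G B = \<lparr> verts = B, edges = {e \<in> edges G. e \<subseteq> B} \<rparr>"

definition proper_coloring :: "'a ugraph \<Rightarrow> nat \<Rightarrow> ('a \<Rightarrow> nat) \<Rightarrow> bool" where
  "proper_coloring G k f \<longleftrightarrow>
     f ` verts G \<subseteq> {..<k} \<and> (\<forall>u v. {u, v} \<in> edges G \<longrightarrow> f u \<noteq> f v)"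

definition chromatic_number :: "'a ugraph \<Rightarrow> nat" where
  "chromatic_number G = (LEAST k. \<exists>f. proper_coloring G k f)"

text \<open>A sequence of bags is a list; it is required to be non-empty, so that the maximum
  over its bags below is meaningful.\<close>

definition path_decomposition :: "'a ugraph \<Rightarrow> 'a set list \<Rightarrow> bool" where
  "path_decomposition G Bs \<longleftrightarrow>
     Bs \<noteq> [] \<and>
     \<Union> (set Bs) = verts G \<and>
     (\<forall>u v. {u, v} \<in> edges G \<longrightarrow> (\<exists>B\<in>set Bs. u \<in> B \<and> v \<in> B)) \<and>
     (\<forall>v\<in>verts G. \<forall>i j l. i \<le> j \<and> j \<le> l \<and> l < length Bs \<and> v \<in> Bs ! i \<and> v \<in> Bs ! l
        \<longrightarrow> v \<in> Bs ! j)"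

definition decomposition_chromatic_number :: "'a ugraph \<Rightarrow> 'a set list \<Rightarrow> nat" where
  "decomposition_chromatic_number G Bs =
     Max ((\<lambda>B. chromatic_number (induced_subgraph G B)) ` set Bs)"

definition path_chromatic_number :: "'a ugraph \<Rightarrow> nat" where
  "path_chromatic_number G =
     (LEAST m. \<exists>Bs. path_decomposition G Bs \<and> m = decomposition_chromatic_number G Bs)"

text \<open>One step of the Mycielski construction, for a graph with vertex set \<open>{..<N}\<close>:
  the old vertices \<open>v\<^sub>1, \<dots>, v\<^sub>N\<close> are \<open>0, \<dots>, N - 1\<close>, the new vertices \<open>u\<^sub>1, \<dots>, u\<^sub>N\<close> are
  \<open>N, \<dots>, 2N - 1\<close> (so \<open>N + i\<close> is the new vertex belonging to \<open>i\<close>), and \<open>w\<close> is \<open>2N\<close>.\<close>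

definition mycielski_step :: "nat ugraph \<Rightarrow> nat ugraph" where
  "mycielski_step G = (let N = card (verts G) in
     \<lparr> verts = {..<2 * N + 1},
       edges = edges G
         \<union> {{2 * N, N + i} | i. i < N}
         \<union> {{N + i, j} | i j. i < N \<and> j < N \<and> i \<noteq> j \<and> {i, j} \<in> edges G} \<rparr>)"

text \<open>The \<open>k\<close>-Mycielski graph; meaningful only for \<open>k \<ge> 2\<close>
  (by truncated subtraction the values at \<open>0\<close> and \<open>1\<close> coincide with that at \<open>2\<close>).\<close>

definition mycielski :: "nat \<Rightarrow> nat ugraph" where
  "mycielski k = (mycielski_step ^^ (k - 2)) \<lparr> verts = {..<2}, edges = {{0, 1}} \<rparr>"

lemma mycielski_2: "mycielski 2 = \<lparr> verts = {..<2}, edges = {{0, 1}} \<rparr>"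
  by (simp add: mycielski_def)

lemma mycielski_Suc: "2 \<le> k \<Longrightarrow> mycielski (Suc k) = mycielski_step (mycielski k)"
proof -
  assume "2 \<le> k"
  then have "Suc k - 2 = Suc (k - 2)"
    by linarith
  then show ?thesis
    unfolding mycielski_def by (simp only: funpow.simps comp_apply)
qed

lemma verts_mycielski:
  assumes "2 \<le> k"
  shows "verts (mycielski k) = {..<3 * 2 ^ (k - 2) - 1}"
  using assms
proof (induction k rule: nat_induct_at_least)
  case base
  then show ?case by (simp add: mycielski_2)
next
  case (Suc k)
  have "2 * (3 * 2 ^ (k - 2) - 1) + 1 = 3 * 2 ^ (Suc k - 2) - (1::nat)"
  proof -
    have "Suc k - 2 = Suc (k - 2)"
      using Suc.hyps by linarith
    then show ?thesis
      using one_le_power[of "2::nat" "k - 2"] by (simp only: power_Suc) linarith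
  qed
  then show ?case
    using Suc by (simp add: mycielski_Suc mycielski_step_def Let_def)
qed

lemma finite_simple_graph_mycielski:
  assumes "2 \<le> k"
  shows "finite_simple_graph (mycielski k)"
  using assms
proof (induction k rule: nat_induct_at_least)
  case base
  then show ?case by (auto simp: mycielski_2 finite_simple_graph_def)
next
  case (Suc k)
  define N where "N = card (verts (mycielski k))"
  have V: "verts (mycielski k) = {..<N}"
    using verts_mycielski[OF Suc.hyps(1)] by (simp add: N_def)
  have old: "e \<subseteq> {..<2 * N + 1} \<and> card e = 2" if "e \<in> edges (mycielski k)" for e
    using Suc.IH that V unfolding finite_simple_graph_def by fastforce
  show ?case
    using old Suc.hyps
    by (auto simp: mycielski_Suc mycielski_step_def finite_simple_graph_def Let_def
        simp flip: N_def)
qed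

end

theory Submission
  imports Defs Complex_Main "HOL-Library.FuncSet"
begin

text \<open>The path-chromatic number is monotone under homomorphisms, and every triangle-free graph
  maps homomorphically to some Mycielski graph. It therefore suffices to find a triangle-free graph
  of large path-chromatic number. Deleting a vertex from every triangle of a sparse random graph
  gives one in which any two disjoint sets of \<open>s\<close> vertices are joined by an edge, where
  \<open>s\<close> is a small fraction of the number of vertices. In a path-decomposition of such a graph,
  fewer than \<open>s\<close> vertices can lie entirely to the left of a suitable bag and fewer than
  \<open>s\<close> entirely to the right. This bag contains almost all vertices, but independent sets
  have fewer than \<open>2 s\<close> elements.\<close>

section \<open>Homomorphisms\<close>

definition graph_hom :: "'a ugraph \<Rightarrow> 'b ugraph \<Rightarrow> ('a \<Rightarrow> 'b) \<Rightarrow> bool" where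
  "graph_hom G H h \<longleftrightarrow> h ` verts G \<subseteq> verts H \<and>
     (\<forall>x y. {x, y} \<in> edges G \<longrightarrow> {h x, h y} \<in> edges H)"

text \<open>Expresses that the path-chromatic number is at most \<open>c\<close> without
  \<open>LEAST\<close> and \<open>Max\<close>, so that a decomposition can be pulled back bag by
  bag.\<close>

definition path_colorable :: "'a ugraph \<Rightarrow> nat \<Rightarrow> bool" where
  "path_colorable G c \<longleftrightarrow> (\<exists>Bs. path_decomposition G Bs \<and>
     (\<forall>B\<in>set Bs. \<exists>f. proper_coloring (induced_subgraph G B) c f))"

lemma finite_simple_graph_edgeD:
  assumes "finite_simple_graph G" "{x, y} \<in> edges G"
  shows "x \<in> verts G" "y \<in> verts G" "x \<noteq> y"
proof -
  have "{x, y} \<subseteq> verts G \<and> card {x, y} = 2"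
    using assms unfolding finite_simple_graph_def by blast
  then show "x \<in> verts G" "y \<in> verts G" "x \<noteq> y"
    by auto
qed

lemma ex_proper_coloring_induced:
  assumes G: "finite_simple_graph G" and "finite B"
  shows "\<exists>k f. proper_coloring (induced_subgraph G B) k f"
proof -
  obtain f :: "'a \<Rightarrow> nat" and k where f: "f ` B = {i. i < k}" "inj_on f B"
    using finite_imp_inj_to_nat_seg[OF \<open>finite B\<close>] by metis
  have "proper_coloring (induced_subgraph G B) k f"
    unfolding proper_coloring_def induced_subgraph_def
    using f finite_simple_graph_edgeD(3)[OF G] by (auto dest: inj_onD)
  then show ?thesis by blast
qed

lemma path_colorable_if_path_chromatic_number_le:
  assumes G: "finite_simple_graph G" and c: "path_chromatic_number G \<le> c"
  shows "path_colorable G c"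
proof -
  \<comment> \<open>The one-bag decomposition shows that the minimum defining
    \<open>path_chromatic_number\<close> ranges over a nonempty set and is therefore
    attained.\<close>
  have "path_decomposition G [verts G]"
    unfolding path_decomposition_def
    using finite_simple_graph_edgeD[OF G] by auto
  then have "\<exists>m Bs. path_decomposition G Bs \<and> m = decomposition_chromatic_number G Bs"
    by blast
  then have "\<exists>Bs. path_decomposition G Bs \<and>
      path_chromatic_number G = decomposition_chromatic_number G Bs"
    unfolding path_chromatic_number_def by (rule LeastI_ex)
  then obtain Bs where Bs: "path_decomposition G Bs"
    and eq: "path_chromatic_number G = decomposition_chromatic_number G Bs"
    by blast
  have "\<exists>f. proper_coloring (induced_subgraph G B) c f" if B: "B \<in> set Bs" for B
  proof -
    have "B \<subseteq> verts G"
      using B Bs unfolding path_decomposition_def by blast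
    then have "finite B"
      using G finite_subset unfolding finite_simple_graph_def by blast
    from LeastI_ex[OF ex_proper_coloring_induced[OF G this]]
    obtain f where f: "proper_coloring (induced_subgraph G B)
        (chromatic_number (induced_subgraph G B)) f"
      unfolding chromatic_number_def by blast
    have "chromatic_number (induced_subgraph G B) \<le> c"
      using c B unfolding eq decomposition_chromatic_number_def
      by (meson Max_ge finite_imageI finite_set imageI le_trans)
    then show ?thesis
      using f unfolding proper_coloring_def by (meson lessThan_subset_iff order_trans)
  qed
  then show ?thesis
    using Bs unfolding path_colorable_def by blast
qed

text \<open>The preimages under \<open>h\<close> of the bags of \<open>H\<close> form a
  path-decomposition of \<open>G\<close>, and a colouring of a bag composed with \<open>h\<close>
  colours its preimage.\<close>

lemma path_colorable_hom:
  assumes G: "finite_simple_graph G" and h: "graph_hom G H h" and H: "path_colorable H c"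
  shows "path_colorable G c"
proof -
  obtain Bs where Bs: "path_decomposition H Bs"
    and col: "\<And>B. B \<in> set Bs \<Longrightarrow> \<exists>f. proper_coloring (induced_subgraph H B) c f"
    using H unfolding path_colorable_def by blast
  define pull where "pull B = {x \<in> verts G. h x \<in> B}" for B
  have hv: "h x \<in> verts H" if "x \<in> verts G" for x
    using h that unfolding graph_hom_def by blast
  have he: "{h x, h y} \<in> edges H" if "{x, y} \<in> edges G" for x y
    using h that unfolding graph_hom_def by blast
  have union: "\<Union> (set (map pull Bs)) = verts G"
    using hv Bs unfolding path_decomposition_def pull_def by auto
  have edge: "\<exists>B\<in>set (map pull Bs). u \<in> B \<and> v \<in> B" if e: "{u, v} \<in> edges G" for u v
  proof -
    obtain B where "B \<in> set Bs" "h u \<in> B" "h v \<in> B"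
      using Bs he[OF e] unfolding path_decomposition_def by meson
    then show ?thesis
      using finite_simple_graph_edgeD[OF G e] by (auto simp: pull_def)
  qed
  have interval: "v \<in> map pull Bs ! j"
    if "v \<in> verts G" "i \<le> j" "j \<le> l" "l < length (map pull Bs)"
      "v \<in> map pull Bs ! i" "v \<in> map pull Bs ! l" for v i j l
  proof -
    have len: "l < length Bs" using that by simp
    have "h v \<in> Bs ! i" "h v \<in> Bs ! l"
      using that by (auto simp: pull_def)
    then have "h v \<in> Bs ! j"
      using Bs hv[OF that(1)] that(2,3) len unfolding path_decomposition_def by blast
    then show ?thesis
      using that len by (simp add: pull_def)
  qed
  have "map pull Bs \<noteq> []"
    using Bs unfolding path_decomposition_def by simp
  with union edge interval have "path_decomposition G (map pull Bs)"
    unfolding path_decomposition_def by (intro conjI ballI allI impI) (assumption | elim conjE)+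
  moreover have "\<exists>f. proper_coloring (induced_subgraph G B') c f"
    if B': "B' \<in> set (map pull Bs)" for B'
  proof -
    obtain B where B: "B \<in> set Bs" "B' = pull B" using B' by auto
    obtain f where f: "proper_coloring (induced_subgraph H B) c f"
      using col[OF B(1)] by blast
    have "proper_coloring (induced_subgraph G B') c (f \<circ> h)"
      using f he unfolding proper_coloring_def induced_subgraph_def B(2) pull_def by auto
    then show ?thesis by blast
  qed
  ultimately show ?thesis
    unfolding path_colorable_def by blast
qed

section \<open>Mapping triangle-free graphs into Mycielski graphs\<close>

definition triangle_free :: "'a ugraph \<Rightarrow> bool" where
  "triangle_free G \<longleftrightarrow>
     \<not> (\<exists>x y z. {x, y} \<in> edges G \<and> {y, z} \<in> edges G \<and> {x, z} \<in> edges G)"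

text \<open>Delete a vertex \<open>v\<close>: it is sent to the apex of the next Mycielski graph and its
  neighbours, which are pairwise non-adjacent, to the twins of their images.\<close>

lemma triangle_free_hom_mycielski:
  assumes "finite_simple_graph G" "triangle_free G"
  shows "\<exists>h. graph_hom G (mycielski (card (verts G) + 2)) h"
  using assms
proof (induction "card (verts G)" arbitrary: G)
  case 0
  then have "verts G = {}" by (simp add: finite_simple_graph_def)
  moreover have "edges G = {}"
    using 0 \<open>verts G = {}\<close> by (auto simp: finite_simple_graph_def)
  ultimately show ?case by (simp add: graph_hom_def)
next
  case (Suc n)
  note G = \<open>finite_simple_graph G\<close>
  have fin: "finite (verts G)" using G by (simp add: finite_simple_graph_def)
  obtain v where v: "v \<in> verts G" using Suc.hyps(2) by fastforce
  define G' where "G' = induced_subgraph G (verts G - {v})"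
  have "n = card (verts G')"
    using Suc.hyps(2) v fin by (simp add: G'_def induced_subgraph_def)
  moreover have "finite_simple_graph G'" "triangle_free G'"
    using Suc.prems fin
    by (auto simp: G'_def induced_subgraph_def finite_simple_graph_def triangle_free_def)
  ultimately obtain h where h: "graph_hom G' (mycielski (n + 2)) h"
    using Suc.hyps(1) by metis
  define M where "M = mycielski (n + 2)"
  define N where "N = card (verts M)"
  have M: "finite_simple_graph M"
    using finite_simple_graph_mycielski[of "n + 2"] by (simp add: M_def)
  have VM: "verts M = {..<N}"
    using verts_mycielski[of "n + 2"] by (simp add: M_def N_def)
  define h' where
    "h' x = (if x = v then 2 * N else if {v, x} \<in> edges G then N + h x else h x)" for x
  have hN: "h x < N" if "x \<in> verts G" "x \<noteq> v" for x
    using h that VM unfolding graph_hom_def G'_def induced_subgraph_def M_def by auto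
  have he: "{h x, h y} \<in> edges M" if "{x, y} \<in> edges G" "x \<noteq> v" "y \<noteq> v" for x y
    using h that finite_simple_graph_edgeD[OF G that(1)]
    unfolding graph_hom_def G'_def induced_subgraph_def M_def by auto
  have step: "mycielski (card (verts G) + 2) = mycielski_step M"
    using mycielski_Suc[of "n + 2"] unfolding M_def Suc.hyps(2)[symmetric] by simp
  \<comment> \<open>Only one orientation of each edge is treated: \<open>x\<close> is the endpoint
    at least as close to \<open>v\<close>, in the order \<open>v\<close>, neighbours of
    \<open>v\<close>, other vertices. Symmetry of \<open>{x, y}\<close> gives the other
    orientation.\<close>
  have adj: "{h' x, h' y} \<in> edges (mycielski_step M)"
    if e: "{x, y} \<in> edges G" and y: "y \<noteq> v" and x: "x = v \<or> {v, x} \<in> edges G \<or> {v, y} \<notin> edges G"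
    for x y
  proof -
    note xy = finite_simple_graph_edgeD[OF G e]
    consider "x = v" | "x \<noteq> v" "{v, x} \<in> edges G" | "x \<noteq> v" "{v, x} \<notin> edges G" "{v, y} \<notin> edges G"
      using x by blast
    then show ?thesis
    proof cases
      case 1
      then have "h' x = 2 * N" "h' y = N + h y" "h y < N"
        using e y xy hN by (auto simp: h'_def)
      then show ?thesis
        by (auto simp: mycielski_step_def Let_def simp flip: N_def)
    next
      \<comment> \<open>Triangle-freeness is used here: two adjacent neighbours of \<open>v\<close>
        would both go to twins, and twins are pairwise non-adjacent. So \<open>y\<close> keeps its
        old image, and an old edge yields an edge between twin and old vertex.\<close>
      case 2
      then have "{v, y} \<notin> edges G"
        using Suc.prems(2) e unfolding triangle_free_def by blast
      then have h': "h' x = N + h x" "h' y = h y"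
        using 2 y by (auto simp: h'_def)
      have "{h x, h y} \<in> edges M" using he[OF e 2(1) y] .
      moreover from this have "h x \<noteq> h y" using finite_simple_graph_edgeD[OF M] by blast
      moreover have "h x < N" "h y < N" using hN xy 2 y by auto
      ultimately show ?thesis
        unfolding h' by (auto simp: mycielski_step_def Let_def simp flip: N_def)
    next
      case 3
      then have "h' x = h x" "h' y = h y" using y by (auto simp: h'_def)
      then show ?thesis
        using he[OF e 3(1) y] by (simp add: mycielski_step_def Let_def)
    qed
  qed
  have "{h' x, h' y} \<in> edges (mycielski_step M)" if e: "{x, y} \<in> edges G" for x y
  proof (cases "y \<noteq> v \<and> (x = v \<or> {v, x} \<in> edges G \<or> {v, y} \<notin> edges G)")
    case True
    then show ?thesis using adj[OF e] by blast
  next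
    case False
    have "{y, x} \<in> edges G" using e by (simp add: insert_commute)
    moreover have "x \<noteq> v" "y = v \<or> {v, y} \<in> edges G"
      using False finite_simple_graph_edgeD(3)[OF G e] by auto
    ultimately have "{h' y, h' x} \<in> edges (mycielski_step M)" using adj by blast
    then show ?thesis by (simp add: insert_commute)
  qed
  moreover have "h' x < 2 * N + 1" if "x \<in> verts G" for x
    using hN[OF that] by (auto simp: h'_def)
  then have "h' ` verts G \<subseteq> verts (mycielski_step M)"
    by (auto simp: mycielski_step_def Let_def simp flip: N_def)
  ultimately show ?case
    unfolding step graph_hom_def by blast
qed

section \<open>Graphs without sparse pairs\<close>

text \<open>Equivalently, for a finite vertex set, the complement graph contains no complete
  bipartite graph with \<open>s\<close> vertices on each side.\<close>

definition joined_sets :: "'a ugraph \<Rightarrow> nat \<Rightarrow> bool" where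
  "joined_sets G s \<longleftrightarrow> (\<forall>A B. A \<subseteq> verts G \<and> B \<subseteq> verts G \<and> A \<inter> B = {} \<and> card A = s \<and> card B = s
     \<longrightarrow> (\<exists>a\<in>A. \<exists>b\<in>B. {a, b} \<in> edges G))"

lemma joined_setsD:
  assumes "joined_sets G s" "A \<subseteq> verts G" "B \<subseteq> verts G" "A \<inter> B = {}" "s \<le> card A" "s \<le> card B"
  shows "\<exists>a\<in>A. \<exists>b\<in>B. {a, b} \<in> edges G"
proof -
  obtain A' B' where "A' \<subseteq> A" "card A' = s" "B' \<subseteq> B" "card B' = s"
    using assms(5,6) by (meson obtain_subset_with_card_n)
  moreover from this have "\<exists>a\<in>A'. \<exists>b\<in>B'. {a, b} \<in> edges G"
    using assms(1-4) unfolding joined_sets_def by (smt (verit) disjoint_iff subset_iff)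
  ultimately show ?thesis by blast
qed

text \<open>A colour class with more than \<open>2 * s\<close> vertices would split into two
  disjoint sets of at least \<open>s\<close> vertices with no edge between them. Hence
  \<open>c\<close> classes cover at most \<open>2 * c * s\<close> vertices.\<close>

lemma card_le_if_proper_coloring:
  assumes G: "finite_simple_graph G" and joined: "joined_sets G s" and "B \<subseteq> verts G"
    and f: "proper_coloring (induced_subgraph G B) c f"
  shows "card B \<le> 2 * c * s"
proof -
  have finB: "finite B"
    using assms finite_subset unfolding finite_simple_graph_def by blast
  define K where "K i = {v \<in> B. f v = i}" for i
  have "card (K i) \<le> 2 * s" for i
  proof (rule ccontr)
    assume "\<not> card (K i) \<le> 2 * s"
    then obtain A where A: "A \<subseteq> K i" "card A = s"
      by (metis obtain_subset_with_card_n nat_le_linear mult_2 trans_le_add1)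
    have finK: "finite (K i)" using finB by (simp add: K_def)
    then have "s \<le> card (K i - A)"
      using A \<open>\<not> card (K i) \<le> 2 * s\<close> by (simp add: card_Diff_subset finite_subset)
    moreover have "K i \<subseteq> verts G" using \<open>B \<subseteq> verts G\<close> by (auto simp: K_def)
    ultimately obtain a b where "a \<in> A" "b \<in> K i - A" "{a, b} \<in> edges G"
      using joined_setsD[OF joined, of A "K i - A"] A by blast
    then show False
      using f A unfolding K_def proper_coloring_def induced_subgraph_def by auto
  qed
  moreover have "B = (\<Union>i<c. K i)"
    using f unfolding K_def proper_coloring_def induced_subgraph_def by auto
  ultimately have "card B \<le> (\<Sum>i<c. 2 * s)"
    using card_UN_le[of "{..<c}" K] sum_mono[of "{..<c}" "\<lambda>i. card (K i)" "\<lambda>_. 2 * s"] by simp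
  then show ?thesis by (simp add: ac_simps)
qed

text \<open>Some bag misses at most \<open>2 * (s - 1)\<close> vertices, so it has more than
  \<open>2 * c * s\<close> of them, too many for \<open>c\<close> colours.\<close>

lemma not_path_colorable:
  assumes G: "finite_simple_graph G" and joined: "joined_sets G s"
    and "0 < s" and N: "2 * (c + 1) * s \<le> card (verts G)"
  shows "\<not> path_colorable G c"
proof
  assume "path_colorable G c"
  then obtain Bs where Bs: "path_decomposition G Bs"
    and col: "\<And>B. B \<in> set Bs \<Longrightarrow> \<exists>f. proper_coloring (induced_subgraph G B) c f"
    unfolding path_colorable_def by blast
  have fin: "finite (verts G)" using G by (simp add: finite_simple_graph_def)
  have cover: "\<exists>i<length Bs. v \<in> Bs ! i" if "v \<in> verts G" for v
    using Bs that unfolding path_decomposition_def by (metis UnionE in_set_conv_nth)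
  define before where "before t = {v \<in> verts G. \<forall>j<length Bs. v \<in> Bs ! j \<longrightarrow> j < t}" for t
  define after where "after t = {v \<in> verts G. \<forall>j<length Bs. v \<in> Bs ! j \<longrightarrow> t < j}" for t
  have "before (length Bs) = verts G" by (auto simp: before_def)
  moreover have "s \<le> card (verts G)"
    using N by (simp add: algebra_simps)
  ultimately have ex: "s \<le> card (before (length Bs))" by simp
  \<comment> \<open>The earliest cut with at least \<open>s\<close> vertices entirely to its left.
    The large bag is the one just before it, with index \<open>t = u - 1\<close>; by minimality
    fewer than \<open>s\<close> vertices end before \<open>t\<close>.\<close>
  define u where "u = (LEAST t. s \<le> card (before t))"
  have u: "s \<le> card (before u)" and ulen: "u \<le> length Bs"
    unfolding u_def using ex by (auto intro: LeastI Least_le)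
  have "before 0 = {}" using cover by (auto simp: before_def)
  then obtain t where t: "u = Suc t"
    using u \<open>0 < s\<close> by (cases u) auto
  have "\<not> s \<le> card (before t)"
    using t unfolding u_def by (metis lessI not_less_Least)
  moreover have "\<not> s \<le> card (after t)"
  proof
    assume "s \<le> card (after t)"
    \<comment> \<open>Because \<open>u = Suc t\<close>, vertices of \<open>before u\<close> occur
      only in bags up to \<open>t\<close> and those of \<open>after t\<close> only in later ones.
      The two sets share no vertex, and no bag can contain an edge between them.\<close>
    moreover have "before u \<inter> after t = {}"
      using cover unfolding before_def after_def t by fastforce
    ultimately obtain a b where ab: "a \<in> before u" "b \<in> after t" "{a, b} \<in> edges G"
      using joined_setsD[OF joined, of "before u" "after t"] u
      unfolding before_def after_def by blast
    then obtain j where "j < length Bs" "a \<in> Bs ! j" "b \<in> Bs ! j"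
      using Bs unfolding path_decomposition_def by (metis in_set_conv_nth)
    then show False
      using ab unfolding before_def after_def t by fastforce
  qed
  moreover have bags: "verts G \<subseteq> before t \<union> after t \<union> Bs ! t"
  proof
    fix v assume v: "v \<in> verts G"
    show "v \<in> before t \<union> after t \<union> Bs ! t"
    proof (cases "v \<in> before t \<or> v \<in> after t")
      case False
      \<comment> \<open>A vertex in neither set has a bag at or before \<open>t\<close> and one at
        or after \<open>t\<close>; since its bags are consecutive, it lies in bag
        \<open>t\<close>.\<close>
      then obtain i l where "i \<le> t" "t \<le> l" "l < length Bs" "v \<in> Bs ! i" "v \<in> Bs ! l"
        using v unfolding before_def after_def by (auto simp: not_less)
      then show ?thesis
        using Bs v unfolding path_decomposition_def by blast
    qed auto
  qed
  moreover have bag: "Bs ! t \<in> set Bs" using ulen t by simp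
  then have sub: "Bs ! t \<subseteq> verts G"
    using Bs unfolding path_decomposition_def by blast
  moreover have "card (Bs ! t) \<le> 2 * c * s"
    using col[OF bag] card_le_if_proper_coloring[OF G joined sub] by blast
  moreover have "card (verts G) \<le> card (before t) + card (after t) + card (Bs ! t)"
  proof -
    have "finite (before t \<union> after t \<union> Bs ! t)"
      using fin sub finite_subset unfolding before_def after_def by auto
    then have "card (verts G) \<le> card (before t \<union> after t \<union> Bs ! t)"
      by (rule card_mono[OF _ bags])
    also have "\<dots> \<le> card (before t) + card (after t) + card (Bs ! t)"
      using card_Un_le[of "before t \<union> after t" "Bs ! t"] card_Un_le[of "before t" "after t"]
      by linarith
    finally show ?thesis .
  qed
  ultimately show False
    using N by (simp add: algebra_simps)
qed

section \<open>Random triangle-free graphs\<close>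

text \<open>Independence of coordinates, as a count: for nonempty finite \<open>R\<close>, a
  uniformly random function takes values in \<open>Q\<close> on all of \<open>F\<close> with
  probability \<open>(card Q / card R) ^ card F\<close>. It serves both for absent edges between two
  sets and for the three edges of a triangle.\<close>

lemma card_PiE_restrict:
  assumes "finite E" "F \<subseteq> E" "Q \<subseteq> R"
  shows "card {w \<in> E \<rightarrow>\<^sub>E R. \<forall>e\<in>F. w e \<in> Q} = card Q ^ card F * card R ^ (card E - card F)"
proof -
  have "{w \<in> E \<rightarrow>\<^sub>E R. \<forall>e\<in>F. w e \<in> Q} = (\<Pi>\<^sub>E e\<in>E. if e \<in> F then Q else R)"
    using assms(2,3) by (auto simp: PiE_def Pi_def split: if_splits)
  moreover have "E \<inter> F = F" using assms(2) by blast
  moreover have "card (E - F) = card E - card F"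
    using assms(1,2) by (simp add: card_Diff_subset finite_subset)
  ultimately show ?thesis
    using assms(1) by (simp add: card_PiE prod.If_cases if_distrib[of card] Diff_eq)
qed

lemma card_pairs_disjoint:
  assumes "finite A" "finite B" "A \<inter> B = {}"
  shows "card ((\<lambda>(a, b). {a, b}) ` (A \<times> B)) = card A * card B"
proof -
  have "inj_on (\<lambda>(a, b). {a, b}) (A \<times> B)"
    using assms(3) by (auto simp: inj_on_def doubleton_eq_iff)
  then show ?thesis
    by (simp add: card_image card_cartesian_product)
qed

text \<open>Division-free form of \<open>(1 - 1 / r) ^ (r * k) \<le> 1 / 2 ^ k\<close>. For
  \<open>r > 1\<close> and \<open>k = 1\<close>, Bernoulli's inequality bounds
  \<open>(1 + 1 / (r - 1)) ^ r\<close> below by \<open>1 + r / (r - 1)\<close>, which is at least 2;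
  the general case is its \<open>k\<close>-th power.\<close>

lemma power_pred_le:
  assumes "0 < r"
  shows "2 ^ k * (r - 1) ^ (r * k) \<le> (r::nat) ^ (r * k)"
proof -
  have B: "2 * (r - 1) ^ r \<le> r ^ r"
  proof (cases "r = 1")
    case False
    then have r: "r > 1" using assms by simp
    have "2 \<le> 1 + real r * (1 / (real r - 1))"
      using r by (simp add: field_simps)
    also have "\<dots> \<le> (1 + 1 / (real r - 1)) ^ r"
      using r by (intro Bernoulli_inequality) (simp add: order_trans[of _ 0])
    also have "1 + 1 / (real r - 1) = real r / (real r - 1)"
      using r by (simp add: field_simps)
    finally have "2 * (real r - 1) ^ r \<le> real r ^ r"
      using r by (simp add: power_divide field_simps)
    then have "real (2 * (r - 1) ^ r) \<le> real (r ^ r)"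
      using r by (simp add: of_nat_diff)
    then show ?thesis by linarith
  qed simp
  have "2 ^ k * (r - 1) ^ (r * k) = (2 * (r - 1) ^ r) ^ k"
    by (simp add: power_mult power_mult_distrib)
  also have "\<dots> \<le> (r ^ r) ^ k" using B by (rule power_mono) simp
  finally show ?thesis by (simp add: power_mult)
qed

section \<open>The random graph model and its two bad events\<close>

context
  fixes n r :: nat and E :: "nat set set" and W :: "(nat set \<Rightarrow> nat) set"
  assumes r: "1 < r"
  defines "E \<equiv> {e. e \<subseteq> {..<n} \<and> card e = 2}"
  defines "W \<equiv> E \<rightarrow>\<^sub>E {..<r}"
begin

text \<open>A point \<open>w\<close> of the sample space \<open>W\<close> stands for the graph with edges \<open>{e \<in> E. w e = 0}\<close>,
  so that each edge is present with probability \<open>1 / r\<close>.\<close>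

lemma finite_E: "finite E"
  by (simp add: E_def)

lemma finite_W: "finite W"
  by (simp add: W_def finite_E finite_PiE)

lemma card_W: "card W = r ^ card E"
  by (simp add: W_def card_PiE finite_E)

text \<open>Union bound. For fixed \<open>A\<close> and \<open>B\<close> all
  \<open>s * s = r * k\<close> possible edges between them are absent with probability at most
  \<open>1 / 2 ^ k\<close>. There are at most \<open>2 ^ (2 * n)\<close> such pairs, so
  \<open>k \<ge> 2 * n + 2\<close> leaves total probability at most 1/4.\<close>

lemma card_not_joined:
  assumes "s * s = r * k" "2 * n + 2 \<le> k"
  shows "4 * card {w \<in> W. \<exists>A B. A \<subseteq> {..<n} \<and> B \<subseteq> {..<n} \<and> A \<inter> B = {} \<and> card A = s \<and> card B = s
    \<and> (\<forall>a\<in>A. \<forall>b\<in>B. w {a, b} \<noteq> 0)} \<le> card W"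
    (is "4 * card ?bad \<le> _")
proof -
  define P where "P = {(A, B). A \<subseteq> {..<n} \<and> B \<subseteq> {..<n} \<and> A \<inter> B = {} \<and> card A = s \<and> card B = s}"
  define bad where "bad = (\<lambda>(A, B). {w \<in> W. \<forall>a\<in>A. \<forall>b\<in>B. w {a, b} \<noteq> 0})"
  have PP: "P \<subseteq> Pow {..<n} \<times> Pow {..<n}" by (auto simp: P_def)
  then have finP: "finite P" by (rule finite_subset) simp
  have "card P \<le> card (Pow {..<n} \<times> Pow {..<n})"
    using PP by (intro card_mono) simp_all
  also have "\<dots> = 2 ^ (2 * n)"
    by (simp add: card_cartesian_product card_Pow mult_2 power_add)
  finally have cardP: "card P \<le> 2 ^ (2 * n)" .
  have one: "2 ^ k * card (bad p) \<le> card W" if p_in: "p \<in> P" for p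
  proof -
    obtain A B where p: "p = (A, B)" and AB: "A \<subseteq> {..<n}" "B \<subseteq> {..<n}" "A \<inter> B = {}"
      "card A = s" "card B = s" using p_in unfolding P_def by blast
    have finAB: "finite A" "finite B" using AB finite_subset by blast+
    define F where "F = (\<lambda>(a, b). {a, b}) ` (A \<times> B)"
    have FE: "F \<subseteq> E"
      using AB by (auto simp: F_def E_def intro!: card_2_iff[THEN iffD2] exI)
    have cF: "card F = r * k"
      using card_pairs_disjoint[OF finAB AB(3)] AB assms by (simp add: F_def)
    have "bad p = {w \<in> E \<rightarrow>\<^sub>E {..<r}. \<forall>e\<in>F. w e \<in> {1..<r}}"
      using FE unfolding bad_def p F_def W_def by (auto simp: PiE_def Pi_def Suc_le_eq)
    then have "card (bad p) = (r - 1) ^ (r * k) * r ^ (card E - r * k)"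
      using card_PiE_restrict[OF finite_E FE, of "{1..<r}" "{..<r}"] cF
      by (simp add: subset_iff)
    then have "2 ^ k * card (bad p) \<le> r ^ (r * k) * r ^ (card E - r * k)"
      using power_pred_le[of r k] r by (simp flip: mult.assoc)
    also have "\<dots> = card W"
      using card_mono[OF finite_E FE] cF by (simp add: card_W flip: power_add)
    finally show ?thesis .
  qed
  have "?bad = \<Union> (bad ` P)" by (auto simp: bad_def P_def)
  then have "card ?bad \<le> (\<Sum>p\<in>P. card (bad p))"
    using card_UN_le[OF finP] by metis
  then have "2 ^ k * card ?bad \<le> (\<Sum>p\<in>P. 2 ^ k * card (bad p))"
    by (simp flip: sum_distrib_left)
  also have "\<dots> \<le> card P * card W"
    using sum_mono[of P "\<lambda>p. 2 ^ k * card (bad p)" "\<lambda>_. card W"] one by simp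
  also have "\<dots> \<le> 2 ^ (2 * n) * card W" using cardP by simp
  finally have *: "2 ^ k * card ?bad \<le> 2 ^ (2 * n) * card W" .
  have "2 ^ (2 * n) * (4 * card ?bad) = 2 ^ (2 * n + 2) * card ?bad" by (simp add: power_add)
  also have "\<dots> \<le> 2 ^ k * card ?bad"
    using assms(2) by (intro mult_right_mono power_increasing) auto
  also note *
  finally show ?thesis by simp
qed

definition triangles :: "(nat set \<Rightarrow> nat) \<Rightarrow> nat set set" where
  "triangles w = {t. t \<subseteq> {..<n} \<and> card t = 3 \<and> (\<forall>e. e \<subseteq> t \<and> card e = 2 \<longrightarrow> w e = 0)}"

lemma finite_triangles: "finite (triangles w)"
  by (rule finite_subset[of _ "Pow {..<n}"]) (auto simp: triangles_def)

text \<open>Markov's inequality. The expected number of triangles is at most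
  \<open>n ^ 3 / r ^ 3\<close>, so more than \<open>n / 2\<close> of them occur with probability at
  most \<open>2 * n ^ 2 / r ^ 3\<close>, which is at most 1/4.\<close>

lemma card_many_triangles:
  assumes "8 * n ^ 2 \<le> r ^ 3" "0 < n"
  shows "4 * card {w \<in> W. n < 2 * card (triangles w)} \<le> card W"
    (is "4 * card ?bad \<le> _")
proof -
  define T where "T = {t. t \<subseteq> {..<n} \<and> card t = 3}"
  have finT: "finite T" by (simp add: T_def)
  have cT: "card T \<le> n ^ 3"
  proof -
    have "card T = n choose 3" unfolding T_def using n_subsets[of "{..<n}" 3] by simp
    also have "\<dots> \<le> n ^ 3" by (cases "3 \<le> n") (auto simp: binomial_le_pow binomial_eq_0)
    finally show ?thesis .
  qed
  have one: "r ^ 3 * card {w \<in> W. t \<in> triangles w} = card W" if t: "t \<in> T" for t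
  proof -
    define F where "F = {e. e \<subseteq> t \<and> card e = 2}"
    have fint: "finite t" using t by (auto simp: T_def intro: card_ge_0_finite)
    have cF: "card F = 3"
      using n_subsets[OF fint, of 2] t by (simp add: F_def T_def numeral_eq_Suc)
    have FE: "F \<subseteq> E" using t by (auto simp: F_def T_def E_def)
    have "{w \<in> W. t \<in> triangles w} = {w \<in> E \<rightarrow>\<^sub>E {..<r}. \<forall>e\<in>F. w e \<in> {0}}"
      using t by (auto simp: triangles_def T_def F_def W_def)
    then have "card {w \<in> W. t \<in> triangles w} = r ^ (card E - 3)"
      using card_PiE_restrict[OF finite_E FE, of "{0}" "{..<r}"] cF r by simp
    then show ?thesis
      using card_mono[OF finite_E FE] cF by (simp add: card_W flip: power_add)
  qed
  have sub: "?bad \<subseteq> W" by blast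
  have "card ?bad * n \<le> (\<Sum>w\<in>?bad. 2 * card (triangles w))"
    using sum_mono[of ?bad "\<lambda>_. n" "\<lambda>w. 2 * card (triangles w)"] by auto
  also have "\<dots> \<le> (\<Sum>w\<in>W. 2 * card (triangles w))"
    using finite_W sub by (intro sum_mono2) auto
  also have "\<dots> = 2 * (\<Sum>w\<in>W. card {t \<in> T. t \<in> triangles w})"
    by (simp add: sum_distrib_left triangles_def T_def cong: conj_cong)
  \<comment> \<open>Double counting of the pairs of a sample point and a triangle in it, that is,
    linearity of expectation.\<close>
  also have "(\<Sum>w\<in>W. card {t \<in> T. t \<in> triangles w}) = (\<Sum>t\<in>T. card {w \<in> W. t \<in> triangles w})"
    unfolding card_eq_sum by (rule sum.swap_restrict[OF finite_W finT])
  finally have "r ^ 3 * (card ?bad * n) \<le> 2 * (\<Sum>t\<in>T. r ^ 3 * card {w \<in> W. t \<in> triangles w})"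
    by (simp flip: sum_distrib_left)
  also have "\<dots> = 2 * card T * card W" using one by simp
  also have "\<dots> \<le> 2 * n ^ 3 * card W" using cT by simp
  finally have "n * (r ^ 3 * card ?bad) \<le> n * (2 * n ^ 2 * card W)"
    by (simp add: ac_simps power3_eq_cube power2_eq_square)
  then have "r ^ 3 * card ?bad \<le> 2 * n ^ 2 * card W" using assms(2) by simp
  then have "r ^ 3 * (4 * card ?bad) \<le> 8 * n ^ 2 * card W" by linarith
  also have "\<dots> \<le> r ^ 3 * card W" using assms(1) by simp
  finally show ?thesis using r by simp
qed

text \<open>Each bad event has probability at most 1/4, so some sample point avoids both. Deleting
  one vertex from each of its at most \<open>n / 2\<close> triangles leaves at least half of the
  vertices, and the joining property passes to induced subgraphs.\<close>

lemma ex_triangle_free_joined: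
  assumes "s * s = r * k" "2 * n + 2 \<le> k" "8 * n ^ 2 \<le> r ^ 3" "0 < n"
  shows "\<exists>G :: nat ugraph. finite_simple_graph G \<and> triangle_free G \<and> joined_sets G s
    \<and> n \<le> 2 * card (verts G)"
proof -
  define bad1 where "bad1 = {w \<in> W. \<exists>A B. A \<subseteq> {..<n} \<and> B \<subseteq> {..<n} \<and> A \<inter> B = {} \<and> card A = s
    \<and> card B = s \<and> (\<forall>a\<in>A. \<forall>b\<in>B. w {a, b} \<noteq> 0)}"
  define bad2 where "bad2 = {w \<in> W. n < 2 * card (triangles w)}"
  have "4 * card bad1 \<le> card W"
    unfolding bad1_def by (rule card_not_joined[OF assms(1,2)])
  moreover have "4 * card bad2 \<le> card W"
    unfolding bad2_def by (rule card_many_triangles[OF assms(3,4)])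
  moreover have "0 < card W" using r by (simp add: card_W)
  moreover have "card (bad1 \<union> bad2) \<le> card bad1 + card bad2" by (rule card_Un_le)
  ultimately have "card (bad1 \<union> bad2) < card W" by linarith
  moreover have "finite (bad1 \<union> bad2)" using finite_W by (simp add: bad1_def bad2_def)
  ultimately have "\<not> W \<subseteq> bad1 \<union> bad2" using card_mono[of "bad1 \<union> bad2" W] by linarith
  then obtain w where w: "w \<in> W" "w \<notin> bad1" "w \<notin> bad2" by blast
  \<comment> \<open>One chosen vertex per triangle; distinct triangles may share it, so
    \<open>X\<close> has at most as many elements as there are triangles.\<close>
  define X where "X = (\<lambda>t. SOME x. x \<in> t) ` triangles w"
  define V where "V = {..<n} - X"
  define G where "G = \<lparr>verts = V, edges = {e. e \<subseteq> V \<and> card e = 2 \<and> w e = 0}\<rparr>"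
  have "card X \<le> card (triangles w)"
    unfolding X_def by (rule card_image_le[OF finite_triangles])
  moreover have "2 * card (triangles w) \<le> n" using w by (auto simp: bad2_def)
  moreover have "n - card X \<le> card V"
    using diff_card_le_card_Diff[of X "{..<n}"] finite_triangles by (simp add: V_def X_def)
  ultimately have "n \<le> 2 * card (verts G)" by (simp add: G_def)
  moreover have simple: "finite_simple_graph G"
    by (auto simp: finite_simple_graph_def G_def V_def)
  moreover have "joined_sets G s"
    unfolding joined_sets_def
  proof (intro allI impI, elim conjE)
    fix A B assume AB: "A \<subseteq> verts G" "B \<subseteq> verts G" "A \<inter> B = {}" "card A = s" "card B = s"
    then have "A \<subseteq> {..<n}" "B \<subseteq> {..<n}" by (auto simp: G_def V_def)
    then obtain a b where ab: "a \<in> A" "b \<in> B" "w {a, b} = 0"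
      using w AB unfolding bad1_def by blast
    then have "a \<noteq> b" using AB(3) by blast
    then show "\<exists>a\<in>A. \<exists>b\<in>B. {a, b} \<in> edges G"
      using ab AB by (intro bexI[of _ a] bexI[of _ b]) (auto simp: G_def)
  qed
  moreover have "triangle_free G"
    unfolding triangle_free_def
  proof (intro notI, elim exE conjE)
    fix x y z assume e: "{x, y} \<in> edges G" "{y, z} \<in> edges G" "{x, z} \<in> edges G"
    note d = finite_simple_graph_edgeD[OF simple e(1)] finite_simple_graph_edgeD[OF simple e(2)]
      finite_simple_graph_edgeD[OF simple e(3)]
    have V: "{x, y, z} \<subseteq> V" using d by (simp add: G_def)
    have "w e' = 0" if e': "e' \<subseteq> {x, y, z}" "card e' = 2" for e'
    proof -
      obtain p q where "e' = {p, q}" "p \<noteq> q" using e'(2) by (auto simp: card_2_iff)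
      then have "e' = {x, y} \<or> e' = {y, z} \<or> e' = {x, z}" using e'(1) by auto
      then show ?thesis using e by (auto simp: G_def)
    qed
    \<comment> \<open>A surviving triangle is a triangle of the sampled graph, so its chosen vertex
      was deleted, although all its vertices lie in \<open>V\<close>.\<close>
    then have "{x, y, z} \<in> triangles w"
      using V d by (auto simp: triangles_def V_def)
    then have "(SOME u. u \<in> {x, y, z}) \<in> X" unfolding X_def by blast
    moreover have "(SOME u. u \<in> {x, y, z}) \<in> {x, y, z}" by (rule someI[of _ x]) simp
    ultimately show False using V unfolding V_def by blast
  qed
  ultimately show ?thesis by blast
qed

end

section \<open>Choice of parameters and conclusion\<close>

theorem corollary1p5:
  fixes c :: nat
  assumes "c > 0"
  shows "\<exists>n\<ge>2. path_chromatic_number (mycielski n) > c"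
proof -
  \<comment> \<open>The factor 4 in \<open>q\<close> gives \<open>n / 2 = 2 * (c + 1) * s\<close>,
    the size that rules out \<open>c\<close> colours. The exponent is
    \<open>k = r * j * j = j * s\<close>; with \<open>j = 2 * q + 1\<close> it equals
    \<open>2 * n + s\<close>, enough for the union bound. Since \<open>n = q * j * r\<close>, the
    value of \<open>r\<close> makes \<open>8 * n ^ 2\<close> equal to \<open>r ^ 3\<close>.\<close>
  define q where "q = 4 * (c + 1)"
  define j where "j = 2 * q + 1"
  define r where "r = 8 * (q * j) ^ 2"
  define s where "s = r * j"
  define n where "n = q * s"
  have "0 < q" "0 < j" by (simp_all add: q_def j_def)
  then have "0 < (q * j) ^ 2" by simp
  then have "1 < r" unfolding r_def by linarith
  have "0 < s" using \<open>1 < r\<close> \<open>0 < j\<close> by (simp add: s_def)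
  then have "0 < n" using \<open>0 < q\<close> by (simp add: n_def)
  have "s * s = r * (r * j * j)" by (simp add: s_def)
  moreover have "2 * n + 2 \<le> r * j * j"
  proof -
    have "r * j * j = 2 * n + s" by (simp add: n_def s_def j_def algebra_simps)
    moreover have "r * 1 \<le> s" unfolding s_def using \<open>0 < j\<close> by (intro mult_le_mono2) simp
    ultimately show ?thesis using \<open>1 < r\<close> by simp
  qed
  moreover have "8 * n ^ 2 \<le> r ^ 3"
  proof -
    have "8 * n ^ 2 = (8 * (q * j) ^ 2) * r ^ 2"
      by (simp add: n_def s_def power_mult_distrib)
    also have "\<dots> = r * r ^ 2" unfolding r_def ..
    also have "\<dots> = r ^ 3" by (simp add: power2_eq_square power3_eq_cube)
    finally show ?thesis by simp
  qed
  ultimately obtain G :: "nat ugraph" where G: "finite_simple_graph G" "triangle_free G"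
      "joined_sets G s" "n \<le> 2 * card (verts G)"
    using ex_triangle_free_joined[OF \<open>1 < r\<close>] \<open>0 < n\<close> by blast
  have "2 * (c + 1) * s \<le> card (verts G)"
    using G(4) by (simp add: n_def q_def algebra_simps)
  then have not: "\<not> path_colorable G c"
    using not_path_colorable G \<open>0 < s\<close> by blast
  obtain h where h: "graph_hom G (mycielski (card (verts G) + 2)) h"
    using triangle_free_hom_mycielski G by blast
  have "finite_simple_graph (mycielski (card (verts G) + 2))"
    by (rule finite_simple_graph_mycielski) simp
  then have "\<not> path_chromatic_number (mycielski (card (verts G) + 2)) \<le> c"
    using not path_colorable_hom[OF G(1) h] path_colorable_if_path_chromatic_number_le by blast
  then show ?thesis
    by (intro exI[of _ "card (verts G) + 2"]) simp
qed

end
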